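(* For every $\theta\in\mathbb{R}$ there exist constants $\alpha>0$ and $\gamma_0>0$, depending only on the regularity of the mesh (including the constants $C_0$ and $C_D$ of the context) and on $\theta$, such that for all $\gamma\ge\gamma_0$ and all $v_h\in V_h$ $$a_h(v_h,v_h)\;\ge\;\alpha\,|||v_h|||_h^2 ,$$ where $$|||v_h|||_h^2:=|v_h|_{1,\Omega}^2+\frac1h\,\big\|[\![v_h]\!]\big\|_{0,\mathcal{E}^{\mathrm{ext};o}}^2+\frac1h\sum_{\tilde e\subset\tilde\Gamma_{h;D}}\big\|\mathsf S_{\boldsymbol d}(v_h)\sqrt{j_{\tilde e}}\big\|_{0,\tilde e}^2 .$$
   Context: **Domain and mesh.** $\Omega\subset\mathbb{R}^2$ is a connected open set with Lipschitz boundary $\Gamma=\partial\Omega$ and outward unit normal $\boldsymbol n$; $\Gamma=\overline{\Gamma_D\cup\Gamma_N}$ with $\Gamma_D\cap\Gamma_N=\emptyset$ (Dirichlet and Neumann parts), $\Gamma_D$ of positive measure. $\mathcal D$ is a closed domain with $\overline\Omega\subseteq\mathcal D$, and $\mathcal T_h$ is a family of admissible, shape-regular, quasi-uniform triangulations of $\mathcal D$ with mesh size $h$ (treated as a global constant for each mesh). **Surrogate domain.** $\tilde{\mathcal T}_h=\{T\in\mathcal T_h: T\subset\overline\Omega\}$, $\tilde\Omega_h=\mathrm{int}\bigcup_{T\in\tilde{\mathcal T}_h}T$, $\tilde\Gamma_h=\partial\tilde\Omega_h$ (a union of mesh edges $\tilde e$; each node of $\tilde\Gamma_h$ is the endpoint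 of exactly two of these edges). A map $\boldsymbol M_h:\tilde\Gamma_h\to\Gamma$ is given, with distance vector $\boldsymbol d(\tilde{\boldsymbol x})=\boldsymbol M_h(\tilde{\boldsymbol x})-\tilde{\boldsymbol x}$ and $|\boldsymbol d|\le C_0h$ with $C_0$ independent of $h$. Every edge $\tilde e\subset\tilde\Gamma_h$ is either Dirichlet ($\boldsymbol M_h(\tilde e)\subseteq\Gamma_D$) or Neumann ($\boldsymbol M_h(\tilde e)\subseteq\Gamma_N$); $\tilde\Gamma_{h;D}$ is the union of the Dirichlet edges. **Gap extension.** For an edge $\tilde e\subset\tilde\Gamma_h$ with endpoints $\tilde{\boldsymbol a}_1,\tilde{\boldsymbol a}_2$, $T^{\mathrm{ext}}_{\tilde e}$ is the quadrilateral (with one possibly curved side) bounded by $\tilde e$, the two segments from $\tilde{\boldsymbol a}_i$ to $\boldsymbol M_h(\tilde{\boldsymbol a}_i)$, $i=1,2$, and the side $e^{\mathrm{ext}}$ joining $\boldsymbol M_h(\tilde{\boldsymbol a}_1)$ to $\boldsymbol M_h(\tilde{\boldsymbol a}_2)$. $\tilde{\mathcal T}_h^{\mathrm{ext}}$ is the set of all $T^{\mathrm{ext}}_{\tilde e}$, and $\mathcal E^{\mathrm{ext};o}$ is the set of segments from a node $\tilde{\boldsymbol a}$ of $\tilde\Gamma_h$ to $\boldsymbol M_h(\tilde{\boldsymbol a})$, i.e. the sides of these quadrilaterals lying neither on $\Gamma$ nor on $\tilde\Gamma_h$. Geometric errors are neglected: $e^{\mathrm{ext}}=\boldsymbol M_h(\tilde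 e)\subset\Gamma$, the $T^{\mathrm{ext}}_{\tilde e}$ have disjoint interiors and tile $\Omega\setminus\tilde\Omega_h$, and the Jacobian of $\boldsymbol M_h:\tilde e\to e^{\mathrm{ext}}$ equals the constant $j_{\tilde e}:=|e^{\mathrm{ext}}|/|\tilde e|$. **Standing assumption on $j_{\tilde e}$.** $|j_{\tilde e}|\le C_D$ with $C_D$ independent of $h$ and $\tilde e$. **Space.** $V_h$ is the space of continuous functions on $\tilde\Omega_h$ that are affine on each $T\in\tilde{\mathcal T}_h$. Each $v_h\in V_h$ is identified with its extension to $\Omega$: on $T^{\mathrm{ext}}_{\tilde e}$ it equals the affine polynomial that $v_h$ equals on the element of $\tilde{\mathcal T}_h$ having $\tilde e$ as an edge. The extension may be discontinuous across edges in $\mathcal E^{\mathrm{ext};o}$; $|v_h|_{1,\Omega}$ is the $L^2(\Omega)$ norm of its piecewise gradient. **Jumps, averages, shift.** On an edge shared by two elements with outward unit normals $\boldsymbol n^\pm$: $[\![w]\!]=w^+\boldsymbol n^++w^-\boldsymbol n^-$ for scalar $w$, and $\{\!\{\cdot\}\!\}$ is the arithmetic mean of the two traces. For $\tilde{\boldsymbol x}\in\tilde e\subset\tilde\Gamma_h$, $\mathsf S_{\boldsymbol d}(v)(\tilde{\boldsymbol x})=v(\boldsymbol M_h(\tilde{\boldsymbol x}))$, evaluated from $T^{\mathrm{ext}}_{\tilde e}$; for $v_h\in V_h$ this is $v_h(\tilde{\boldsymbol x})+\nabla v_h(\tilde{\boldsymbol x})\cdot\boldsymbol d(\tilde{\boldsymbol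 x})$ (with $\nabla v_h$ taken on the element attached to $\tilde e$), and $\mathsf S_{\boldsymbol d}(\nabla v_h)=\nabla v_h$. In integrals over $\tilde e$, $\boldsymbol n$ denotes the normal to $\Gamma$ at $\boldsymbol M_h(\tilde{\boldsymbol x})$. **Bilinear form.** With $(\cdot,\cdot)_\omega$ and $\langle\cdot,\cdot\rangle_\sigma$ the $L^2$ inner products on two-dimensional sets and on (unions of) edges (summed over elements/edges), and parameters $\theta\in\mathbb R$, $\gamma\ge0$, $$\begin{aligned}a_h(w,v)=&(\nabla w,\nabla v)_{\tilde\Omega_h}+(\nabla w,\nabla v)_{\tilde{\mathcal T}_h^{\mathrm{ext}}}-\langle[\![w]\!],\{\!\{\nabla v\}\!\}\rangle_{\mathcal E^{\mathrm{ext};o}}-\theta\langle[\![v]\!],\{\!\{\nabla w\}\!\}\rangle_{\mathcal E^{\mathrm{ext};o}}+\langle\gamma h^{-1}[\![w]\!],[\![v]\!]\rangle_{\mathcal E^{\mathrm{ext};o}}\\&-\sum_{\tilde e\subset\tilde\Gamma_{h;D}}\langle\mathsf S_{\boldsymbol d}(w),\mathsf S_{\boldsymbol d}(\nabla v)\cdot\boldsymbol n\,j_{\tilde e}\rangle_{\tilde e}-\theta\sum_{\tilde e\subset\tilde\Gamma_{h;D}}\langle\mathsf S_{\boldsymbol d}(\nabla w)\cdot\boldsymbol n,\mathsf S_{\boldsymbol d}(v)\,j_{\tilde e}\rangle_{\tilde e}+\sum_{\tilde e\subset\tilde\Gamma_{h;D}}\langle\gamma h^{-1}\mathsf S_{\boldsymbol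 d}(w),\mathsf S_{\boldsymbol d}(v)\,j_{\tilde e}\rangle_{\tilde e}.\end{aligned}$$ *)

theory Defs
  imports "HOL-Analysis.Analysis"
begin

type_synonym pt = "real^2"

section \<open>One-dimensional measure, Lipschitz domains, normals\<close>

text \<open>One-dimensional Hausdorff (outer) measure. The covering sets are required to be bounded
  because \<^term>\<open>diameter\<close> carries no information on unbounded sets.\<close>

definition hausdorff1 :: "pt set \<Rightarrow> ennreal" where
  "hausdorff1 A =
     (SUP \<delta>\<in>{0<..}. INF U\<in>{U :: nat \<Rightarrow> pt set.
          A \<subseteq> (\<Union>i. U i) \<and> (\<forall>i. bounded (U i) \<and> diameter (U i) \<le> \<delta>)}.
        (\<Sum>i. ennreal (diameter (U i))))"

definition curve_len :: "pt set \<Rightarrow> real" where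
  "curve_len A = enn2real (hausdorff1 A)"

text \<open>Near each boundary point the set is, in a suitable orthonormal frame, the open region
  strictly below the graph of a Lipschitz function.\<close>

definition lipschitz_boundary :: "pt set \<Rightarrow> bool" where
  "lipschitz_boundary \<Omega> \<longleftrightarrow>
     (\<forall>x\<in>frontier \<Omega>. \<exists>e1 e2 :: pt. \<exists>r>0. \<exists>L. \<exists>\<phi> :: real \<Rightarrow> real.
        norm e1 = 1 \<and> norm e2 = 1 \<and> e1 \<bullet> e2 = 0 \<and> L-lipschitz_on UNIV \<phi> \<and>
        (\<forall>y\<in>ball x r. y \<in> \<Omega> \<longleftrightarrow> y \<bullet> e2 < \<phi> (y \<bullet> e1)))"

text \<open>\<open>\<nu>\<close> is the outward unit normal of \<open>S\<close> at \<open>x\<close>: near \<open>x\<close>, every cone of opening less than a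
  half-plane around \<open>- \<nu>\<close> is inside \<open>S\<close>, and around \<open>\<nu>\<close> outside \<open>S\<close>. At most one \<open>\<nu>\<close> has this
  property, and for a boundary that is locally a graph it exists where the graph is
  differentiable, hence almost everywhere on a Lipschitz boundary.\<close>

definition is_outward_normal :: "pt set \<Rightarrow> pt \<Rightarrow> pt \<Rightarrow> bool" where
  "is_outward_normal S x \<nu> \<longleftrightarrow> x \<in> frontier S \<and> norm \<nu> = 1 \<and>
     (\<forall>\<epsilon>>0. \<exists>\<delta>>0. \<forall>y\<in>ball x \<delta>.
        ((y - x) \<bullet> \<nu> < - \<epsilon> * norm (y - x) \<longrightarrow> y \<in> S) \<and>
        ((y - x) \<bullet> \<nu> > \<epsilon> * norm (y - x) \<longrightarrow> y \<notin> S))"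

text \<open>On the null set of boundary points without a normal the value is 0.\<close>

definition outward_normal :: "pt set \<Rightarrow> pt \<Rightarrow> pt" where
  "outward_normal S x =
     (if \<exists>\<nu>. is_outward_normal S x \<nu> then SOME \<nu>. is_outward_normal S x \<nu> else 0)"

text \<open>The constant outward unit normal of \<open>S\<close> along its straight side \<open>[a, b]\<close>.\<close>

definition side_normal :: "pt set \<Rightarrow> pt \<Rightarrow> pt \<Rightarrow> pt" where
  "side_normal S a b =
     (if \<exists>\<nu>. \<forall>x\<in>open_segment a b. is_outward_normal S x \<nu>
      then SOME \<nu>. \<forall>x\<in>open_segment a b. is_outward_normal S x \<nu> else 0)"

definition seg_integral :: "pt \<Rightarrow> pt \<Rightarrow> (pt \<Rightarrow> real) \<Rightarrow> real" where
  "seg_integral a b f = dist a b * (LINT t:{0..1}|lborel. f (linepath a b t))"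

text \<open>Arc-length integral over a set that is a segment; it does not depend on the orientation
  chosen for the segment.\<close>

definition edge_integral :: "pt set \<Rightarrow> (pt \<Rightarrow> real) \<Rightarrow> real" where
  "edge_integral e f =
     (let (a, b) = (SOME (a, b). e = closed_segment a b) in seg_integral a b f)"

section \<open>Mesh, surrogate domain, gap elements\<close>

text \<open>The data: the domain \<open>\<Omega>\<close>, the Dirichlet and Neumann parts of its boundary, the closed
  domain \<open>\<D>\<close> that is triangulated, the triangulation (its elements being closed triangles), and
  the map \<open>M\<^sub>h\<close>, of which only the values on the surrogate boundary matter.\<close>

record sbm =
  Dom :: "pt set"
  Dir :: "pt set"
  Neu :: "pt set"
  Box :: "pt set"
  Mesh :: "pt set set"
  Proj :: "pt \<Rightarrow> pt"

definition mesh_size :: "pt set set \<Rightarrow> real" where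
  "mesh_size \<T> = Max (diameter ` \<T>)"

definition inball_diameter :: "pt set \<Rightarrow> real" where
  "inball_diameter T = Sup {2 * r | r x. 0 \<le> r \<and> cball x r \<subseteq> T}"

definition admissible_mesh :: "pt set \<Rightarrow> pt set set \<Rightarrow> bool" where
  "admissible_mesh D \<T> \<longleftrightarrow> triangulation \<T> \<and> (\<forall>T\<in>\<T>. 2 simplex T) \<and> \<Union>\<T> = D"

definition shape_regular :: "real \<Rightarrow> pt set set \<Rightarrow> bool" where
  "shape_regular \<sigma> \<T> \<longleftrightarrow> (\<forall>T\<in>\<T>. diameter T \<le> \<sigma> * inball_diameter T)"

definition quasi_uniform :: "real \<Rightarrow> pt set set \<Rightarrow> bool" where
  "quasi_uniform \<kappa> \<T> \<longleftrightarrow> (\<forall>T\<in>\<T>. mesh_size \<T> \<le> \<kappa> * diameter T)"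

definition surr_mesh :: "sbm \<Rightarrow> pt set set" where
  "surr_mesh S = {T \<in> Mesh S. T \<subseteq> closure (Dom S)}"

definition surr_dom :: "sbm \<Rightarrow> pt set" where
  "surr_dom S = interior (\<Union>(surr_mesh S))"

definition surr_edges :: "sbm \<Rightarrow> pt set set" where
  "surr_edges S = {e. e \<subseteq> frontier (surr_dom S) \<and> (\<exists>T\<in>surr_mesh S. e edge_of T)}"

definition surr_nodes :: "sbm \<Rightarrow> pt set" where
  "surr_nodes S = {a. \<exists>e\<in>surr_edges S. a extreme_point_of e}"

definition edges_at :: "sbm \<Rightarrow> pt \<Rightarrow> pt set set" where
  "edges_at S a = {e \<in> surr_edges S. a extreme_point_of e}"

text \<open>Dirichlet and Neumann edges are classified by their relative interiors: two neighbouring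
  edges share a node, whose image cannot lie in both of the disjoint parts of the boundary.\<close>

definition dir_edges :: "sbm \<Rightarrow> pt set set" where
  "dir_edges S = {e \<in> surr_edges S. Proj S ` rel_interior e \<subseteq> Dir S}"

definition neu_edges :: "sbm \<Rightarrow> pt set set" where
  "neu_edges S = {e \<in> surr_edges S. Proj S ` rel_interior e \<subseteq> Neu S}"

definition jac :: "sbm \<Rightarrow> pt set \<Rightarrow> real" where
  "jac S e = curve_len (Proj S ` e) / curve_len e"

definition gap_boundary :: "sbm \<Rightarrow> pt set \<Rightarrow> pt set" where
  "gap_boundary S e =
     e \<union> (\<Union>a\<in>{a. a extreme_point_of e}. closed_segment a (Proj S a)) \<union> Proj S ` e"

text \<open>The region bounded by the closed curve made of the four sides, including the curve.\<close>

definition gap_elem :: "sbm \<Rightarrow> pt set \<Rightarrow> pt set" where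
  "gap_elem S e = gap_boundary S e \<union> inside (gap_boundary S e)"

text \<open>The element carrying a surrogate boundary edge; it is unique, as the edge lies on the
  boundary of the surrogate domain.\<close>

definition attached :: "sbm \<Rightarrow> pt set \<Rightarrow> pt set" where
  "attached S e = (SOME T. T \<in> surr_mesh S \<and> e edge_of T)"

text \<open>In the Jacobian condition \<open>t \<mapsto> M\<^sub>h (linepath a b t)\<close> is differentiated, so that the
  derivative with respect to arc length on \<open>e\<close> is obtained upon division by \<open>dist a b\<close>.\<close>

definition sbm_setting :: "real \<Rightarrow> real \<Rightarrow> real \<Rightarrow> real \<Rightarrow> sbm \<Rightarrow> bool" where
  "sbm_setting \<sigma> \<kappa> C0 CD S \<longleftrightarrow>
     \<comment> \<open>domain and boundary parts\<close>
     open (Dom S) \<and> connected (Dom S) \<and> Dom S \<noteq> {} \<and> lipschitz_boundary (Dom S) \<and>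
     frontier (Dom S) = closure (Dir S \<union> Neu S) \<and> Dir S \<inter> Neu S = {} \<and>
     hausdorff1 (Dir S) > 0 \<and>
     \<comment> \<open>background mesh\<close>
     (\<exists>U. open U \<and> connected U \<and> U \<noteq> {} \<and> Box S = closure U) \<and>
     closure (Dom S) \<subseteq> Box S \<and>
     admissible_mesh (Box S) (Mesh S) \<and> shape_regular \<sigma> (Mesh S) \<and> quasi_uniform \<kappa> (Mesh S) \<and>
     \<comment> \<open>surrogate boundary\<close>
     frontier (surr_dom S) = \<Union>(surr_edges S) \<and>
     (\<forall>a\<in>surr_nodes S. card (edges_at S a) = 2) \<and>
     Proj S ` frontier (surr_dom S) \<subseteq> frontier (Dom S) \<and>
     (\<forall>x\<in>frontier (surr_dom S). norm (Proj S x - x) \<le> C0 * mesh_size (Mesh S)) \<and>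
     surr_edges S = dir_edges S \<union> neu_edges S \<and>
     \<comment> \<open>the gap elements tile the gap\<close>
     (\<Union>e\<in>surr_edges S. gap_elem S e) = closure (Dom S) - surr_dom S \<and>
     pairwise (\<lambda>e e'. interior (gap_elem S e) \<inter> interior (gap_elem S e') = {}) (surr_edges S) \<and>
     \<comment> \<open>the map has constant Jacobian on each edge\<close>
     (\<forall>e\<in>surr_edges S. (\<exists>L. L-lipschitz_on e (Proj S)) \<and>
        (\<forall>a b. e = closed_segment a b \<longrightarrow>
          (AE t\<in>{0<..<1} in lborel. \<exists>D.
             ((\<lambda>t. Proj S (linepath a b t)) has_vector_derivative D) (at t) \<and>
             norm D / dist a b = jac S e))) \<and>
     (\<forall>e\<in>surr_edges S. \<bar>jac S e\<bar> \<le> CD)"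

section \<open>Discrete space, bilinear form, norm\<close>

definition Vh :: "sbm \<Rightarrow> (pt \<Rightarrow> real) set" where
  "Vh S = {v. continuous_on (surr_dom S) v \<and>
     (\<forall>T\<in>surr_mesh S. \<exists>g c. \<forall>x\<in>T \<inter> surr_dom S. v x = g \<bullet> x + c)}"

text \<open>Gradient and constant term of the affine polynomial that \<open>v\<close> equals on \<open>T\<close>; they are
  unique because the surrogate domain contains the interior of \<open>T\<close>.\<close>

definition affine_coeffs :: "sbm \<Rightarrow> (pt \<Rightarrow> real) \<Rightarrow> pt set \<Rightarrow> pt \<times> real" where
  "affine_coeffs S v T = (SOME (g, c). \<forall>x\<in>T \<inter> surr_dom S. v x = g \<bullet> x + c)"

definition elem_grad :: "sbm \<Rightarrow> (pt \<Rightarrow> real) \<Rightarrow> pt set \<Rightarrow> pt" where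
  "elem_grad S v T = fst (affine_coeffs S v T)"

definition elem_poly :: "sbm \<Rightarrow> (pt \<Rightarrow> real) \<Rightarrow> pt set \<Rightarrow> pt \<Rightarrow> real" where
  "elem_poly S v T x = elem_grad S v T \<bullet> x + snd (affine_coeffs S v T)"

text \<open>The extension of \<open>v\<close> to the gap element at \<open>e\<close>, and its gradient.\<close>

definition ext_val :: "sbm \<Rightarrow> (pt \<Rightarrow> real) \<Rightarrow> pt set \<Rightarrow> pt \<Rightarrow> real" where
  "ext_val S v e x = elem_poly S v (attached S e) x"

definition ext_grad :: "sbm \<Rightarrow> (pt \<Rightarrow> real) \<Rightarrow> pt set \<Rightarrow> pt" where
  "ext_grad S v e = elem_grad S v (attached S e)"

text \<open>Piecewise gradient of the extended function. The interiors involved are pairwise disjoint,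
  so at most one summand is nonzero at each point.\<close>

definition pw_grad :: "sbm \<Rightarrow> (pt \<Rightarrow> real) \<Rightarrow> pt \<Rightarrow> pt" where
  "pw_grad S v x =
     (\<Sum>T\<in>surr_mesh S. indicat_real (interior T) x *\<^sub>R elem_grad S v T) +
     (\<Sum>e\<in>surr_edges S. indicat_real (interior (gap_elem S e)) x *\<^sub>R ext_grad S v e)"

text \<open>Jump and average on the segment from the node \<open>a\<close> to \<open>M\<^sub>h a\<close>; the two elements sharing this
  segment are the gap elements of the two surrogate edges meeting at \<open>a\<close>.\<close>

definition jump :: "sbm \<Rightarrow> (pt \<Rightarrow> real) \<Rightarrow> pt \<Rightarrow> pt \<Rightarrow> pt" where
  "jump S v a x =
     (\<Sum>e\<in>edges_at S a. ext_val S v e x *\<^sub>R side_normal (gap_elem S e) a (Proj S a))"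

definition avg_grad :: "sbm \<Rightarrow> (pt \<Rightarrow> real) \<Rightarrow> pt \<Rightarrow> pt" where
  "avg_grad S v a = (1/2) *\<^sub>R (\<Sum>e\<in>edges_at S a. ext_grad S v e)"

definition side_integral :: "sbm \<Rightarrow> (pt \<Rightarrow> pt \<Rightarrow> real) \<Rightarrow> real" where
  "side_integral S f = (\<Sum>a\<in>surr_nodes S. seg_integral a (Proj S a) (f a))"

definition shift :: "sbm \<Rightarrow> (pt \<Rightarrow> real) \<Rightarrow> pt set \<Rightarrow> pt \<Rightarrow> real" where
  "shift S v e x = ext_val S v e (Proj S x)"

definition shifted_normal :: "sbm \<Rightarrow> pt \<Rightarrow> pt" where
  "shifted_normal S x = outward_normal (Dom S) (Proj S x)"

definition a_h :: "real \<Rightarrow> real \<Rightarrow> sbm \<Rightarrow> (pt \<Rightarrow> real) \<Rightarrow> (pt \<Rightarrow> real) \<Rightarrow> real" where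
  "a_h \<theta> \<gamma> S w v = (let h = mesh_size (Mesh S) in
     (LINT x:surr_dom S|lborel. pw_grad S w x \<bullet> pw_grad S v x)
   + (\<Sum>e\<in>surr_edges S. LINT x:gap_elem S e|lborel. pw_grad S w x \<bullet> pw_grad S v x)
   - side_integral S (\<lambda>a x. jump S w a x \<bullet> avg_grad S v a)
   - \<theta> * side_integral S (\<lambda>a x. jump S v a x \<bullet> avg_grad S w a)
   + side_integral S (\<lambda>a x. \<gamma> / h * (jump S w a x \<bullet> jump S v a x))
   - (\<Sum>e\<in>dir_edges S. edge_integral e
        (\<lambda>x. shift S w e x * (ext_grad S v e \<bullet> shifted_normal S x * jac S e)))
   - \<theta> * (\<Sum>e\<in>dir_edges S. edge_integral e
        (\<lambda>x. (ext_grad S w e \<bullet> shifted_normal S x) * (shift S v e x * jac S e)))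
   + (\<Sum>e\<in>dir_edges S. edge_integral e
        (\<lambda>x. \<gamma> / h * shift S w e x * (shift S v e x * jac S e))))"

definition h1_seminorm_sq :: "sbm \<Rightarrow> (pt \<Rightarrow> real) \<Rightarrow> real" where
  "h1_seminorm_sq S v = (LINT x:Dom S|lborel. (norm (pw_grad S v x))\<^sup>2)"

definition triple_norm_sq :: "sbm \<Rightarrow> (pt \<Rightarrow> real) \<Rightarrow> real" where
  "triple_norm_sq S v = (let h = mesh_size (Mesh S) in
     h1_seminorm_sq S v
   + 1 / h * side_integral S (\<lambda>a x. (norm (jump S v a x))\<^sup>2)
   + 1 / h * (\<Sum>e\<in>dir_edges S. edge_integral e (\<lambda>x. (shift S v e x * sqrt (jac S e))\<^sup>2)))"

end

theory Submission
  imports Defs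
begin

text \<open>
  The argument is Nitsche's. On the diagonal \<open>w = v\<close> the form has three kinds of terms. The volume
  terms dominate \<open>|v|\<close> in \<open>H\<^sup>1(\<Omega>)\<close>, because the surrogate domain and the gap elements cover \<open>\<Omega>\<close>
  (\<open>h1_seminorm_le_parts\<close>). The penalty terms are \<open>\<gamma>\<close> times the two boundary contributions \<open>J\<close>
  (jumps) and \<open>D\<close> (shifted Dirichlet values) of the norm. Only the two consistency terms, with the
  common factor \<open>1 + \<theta>\<close>, have no sign.

  Young's inequality with weight \<open>\<delta> h\<close> bounds the consistency terms by \<open>(J + D) / (2 \<delta>)\<close> plus \<open>\<delta> h\<close>
  times integrals of \<open>|\<nabla>v|\<^sup>2\<close> over segments of length \<open>O(h)\<close> (\<open>jump_consistency_le\<close>,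
  \<open>dirichlet_consistency_le\<close>). On these segments \<open>\<nabla>v\<close> is, by the definition of the extension, the
  constant gradient \<open>g\<close> of the triangle attached to a surrogate edge. Shape regularity and
  quasi-uniformity give that triangle an area of at least a multiple of \<open>h\<^sup>2\<close>, and each triangle is
  attached to boundedly many edges, so that the sum of all \<open>h\<^sup>2 |g|\<^sup>2\<close> is at most a constant times
  the energy on the surrogate domain (\<open>sum_edge_gradients_le\<close>). The bound is taken from the
  attached triangle and never from the gap element, which may be arbitrarily thin.

  For \<open>\<delta>\<close> small enough, half of the energy on the surrogate domain absorbs these remainders. A
  penalty \<open>\<gamma>\<close> of at least \<open>1/2 + |1 + \<theta>| / (2 \<delta>)\<close> then absorbs the multiples of \<open>J\<close> and \<open>D\<close>
  (\<open>coercivity\<close>), and \<open>\<alpha> = 1/2\<close> remains.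
\<close>

section \<open>Young's inequality under segment integrals\<close>

lemma inner_le_young:
  fixes x y :: "'a::real_inner"
  assumes "\<epsilon> > 0"
  shows "\<bar>x \<bullet> y\<bar> \<le> (norm x)\<^sup>2 / (2 * \<epsilon>) + \<epsilon> / 2 * (norm y)\<^sup>2"
proof -
  have "0 \<le> (norm x - \<epsilon> * norm y)\<^sup>2 / (2 * \<epsilon>)"
    using assms by simp
  also have "\<dots> = (norm x)\<^sup>2 / (2 * \<epsilon>) + \<epsilon> / 2 * (norm y)\<^sup>2 - norm x * norm y"
    using assms by (simp add: power2_eq_square field_simps)
  finally show ?thesis
    using Cauchy_Schwarz_ineq2[of x y] by linarith
qed

text \<open>If \<open>f\<close> is not integrable, its integral is 0 by convention and the bound holds trivially. This
  matters for the Dirichlet term, whose integrand contains the outward normal, a choice function for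
  which measurability would otherwise have to be established.\<close>

lemma abs_set_integral_le:
  fixes f g :: "'a \<Rightarrow> real"
  assumes g: "set_integrable M A g" and le: "\<And>x. x \<in> A \<Longrightarrow> \<bar>f x\<bar> \<le> g x"
  shows "\<bar>LINT x:A|M. f x\<bar> \<le> (LINT x:A|M. g x)"
proof (cases "set_integrable M A f")
  case True
  then have f: "integrable M (\<lambda>x. indicat_real A x *\<^sub>R f x)"
    by (simp add: set_integrable_def)
  have "\<bar>LINT x:A|M. f x\<bar> \<le> (LINT x|M. \<bar>indicat_real A x *\<^sub>R f x\<bar>)"
    unfolding set_lebesgue_integral_def by (rule integral_abs_bound)
  also have "\<dots> \<le> (LINT x:A|M. g x)"
    unfolding set_lebesgue_integral_def
  proof (rule integral_mono)
    show "\<bar>indicat_real A x *\<^sub>R f x\<bar> \<le> indicat_real A x *\<^sub>R g x" for x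
      using le[of x] by (simp add: indicator_def)
  qed (use f g in \<open>simp_all add: set_integrable_def\<close>)
  finally show ?thesis .
next
  case False
  then have "(LINT x:A|M. f x) = 0"
    unfolding set_integrable_def set_lebesgue_integral_def
    by (simp add: not_integrable_integral_eq)
  moreover have "0 \<le> (LINT x:A|M. g x)"
    unfolding set_lebesgue_integral_def
    using le by (intro Bochner_Integration.integral_nonneg) (force simp: indicator_def)
  ultimately show ?thesis by simp
qed

lemma set_integrable_linepath:
  fixes q :: "pt \<Rightarrow> real"
  assumes "continuous_on (closed_segment a b) q"
  shows "set_integrable lborel {0..1} (\<lambda>t. q (linepath a b t))"
proof (rule borel_integrable_atLeastAtMost')
  show "continuous_on {0..1} (\<lambda>t. q (linepath a b t))"
    by (rule continuous_on_compose2[OF assms])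
       (auto intro: linepath_in_path)
qed

text \<open>The form in which Young's inequality is integrated: \<open>q\<close> is the squared jump or shift, and \<open>c\<close>
  is the contribution of the constant gradient.\<close>

lemma abs_seg_integral_le:
  assumes q: "continuous_on (closed_segment a b) q"
    and le: "\<And>x. x \<in> closed_segment a b \<Longrightarrow> \<bar>f x\<bar> \<le> p * q x + c"
  shows "\<bar>seg_integral a b f\<bar> \<le> p * seg_integral a b q + dist a b * c"
proof -
  let ?I = "\<lambda>f. LINT t:{0..1}|lborel. f (linepath a b t)"
  have int_q: "set_integrable lborel {0..1} (\<lambda>t. p * q (linepath a b t))"
    using set_integrable_linepath[OF q] by simp
  have int_c: "set_integrable lborel {0..1::real} (\<lambda>t. c)"
    by (rule borel_integrable_atLeastAtMost') simp
  have "\<bar>?I f\<bar> \<le> (LINT t:{0..1}|lborel. p * q (linepath a b t) + c)"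
    by (intro abs_set_integral_le set_integral_add int_q int_c le linepath_in_path)
  also have "\<dots> = p * ?I q + c"
    using set_integral_add(2)[OF int_q int_c] by (simp add: set_lebesgue_integral_def)
  finally have "dist a b * \<bar>?I f\<bar> \<le> dist a b * (p * ?I q + c)"
    by (intro mult_left_mono) auto
  then show ?thesis
    by (simp add: seg_integral_def abs_mult algebra_simps)
qed

lemma seg_integral_cmult: "seg_integral a b (\<lambda>x. c * f x) = c * seg_integral a b f"
  by (simp add: seg_integral_def)

lemma edge_integral_eq_seg_integral:
  assumes "e = closed_segment a b"
  obtains a' b' where "e = closed_segment a' b'" "\<And>f. edge_integral e f = seg_integral a' b' f"
proof -
  let ?P = "\<lambda>(a, b). e = closed_segment a b"
  have "?P (SOME p. ?P p)"
    by (rule someI[of ?P "(a, b)"]) (use assms in simp)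
  then show ?thesis
    by (intro that[of "fst (SOME p. ?P p)" "snd (SOME p. ?P p)"])
       (auto simp: edge_integral_def case_prod_unfold Let_def)
qed

lemma edge_integral_cmult:
  "edge_integral e (\<lambda>x. c * f x) = c * edge_integral e f"
  by (simp add: edge_integral_def case_prod_unfold Let_def seg_integral_cmult)

section \<open>Faces and areas of mesh elements\<close>

text \<open>Every face is spanned by a subset of the three vertices. The count of all eight subsets is
  generous, but any bound on the number of edges serves.\<close>

lemma simplex_faces:
  fixes T :: "'a::euclidean_space set"
  assumes "2 simplex T"
  shows "finite {F. F face_of T}" and "card {F. F face_of T} \<le> 8"
proof -
  obtain C where C: "finite C" "\<not> affine_dependent C" "card C = 3" "T = convex hull C"
    using assms by (auto simp: simplex)
  have sub: "{F. F face_of T} \<subseteq> (\<lambda>c. convex hull c) ` Pow C"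
    using face_of_convex_hull_affine_independent[OF C(2)] C(4) by auto
  show "finite {F. F face_of T}"
    using finite_subset[OF sub] C(1) by simp
  have "card {F. F face_of T} \<le> card (Pow C)"
    using sub C(1) by (meson card_image_le card_mono finite_Pow_iff finite_imageI order_trans)
  then show "card {F. F face_of T} \<le> 8"
    using C by (simp add: card_Pow)
qed

lemma edge_of_simplex_is_segment:
  assumes "2 simplex T" "e edge_of T"
  obtains a b where "e = closed_segment a b"
proof -
  have T: "compact T" "convex T"
    using assms(1) polytope_imp_compact polytope_imp_convex simplex_imp_polytope by blast+
  have e: "e face_of T" "aff_dim e = 1"
    using assms(2) by (auto simp: edge_of_def)
  have "e \<noteq> {}" "collinear e"
    using e(2) by (auto simp: collinear_aff_dim)
  with that T e(1) show ?thesis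
    by (meson compact_convex_collinear_segment face_of_imp_compact face_of_imp_convex)
qed

text \<open>An inscribed disc of diameter \<open>2 r\<close> has area \<open>\<pi> r\<^sup>2 = \<pi> (2 r)\<^sup>2 / 4\<close>, which explains the constant; the
  bound passes to the supremum.\<close>

lemma inball_diameter_sq_le_area:
  assumes "T \<noteq> {}" "bounded T"
  shows "0 \<le> inball_diameter T"
    and "(inball_diameter T)\<^sup>2 \<le> 4 / pi * measure lborel (interior T)"
proof -
  let ?R = "{2 * r | r x. 0 \<le> r \<and> cball x r \<subseteq> T}"
  let ?m = "measure lborel (interior T)"
  have bound: "\<rho> \<le> sqrt (4 / pi * ?m)" if \<rho>: "\<rho> \<in> ?R" for \<rho>
  proof -
    obtain r x where r: "\<rho> = 2 * r" "0 \<le> r" "cball x r \<subseteq> T"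
      using \<rho> by auto
    have "measure lborel (ball x r) \<le> ?m"
    proof (rule measure_mono_fmeasurable)
      show "ball x r \<subseteq> interior T"
        using r(3) by (meson ball_subset_cball interior_maximal open_ball order_trans)
      show "interior T \<in> fmeasurable lborel"
        using emeasure_bounded_finite[OF bounded_interior[OF assms(2)]]
        by (intro fmeasurableI) auto
    qed auto
    then have "r\<^sup>2 * pi \<le> ?m"
      using circle_area[OF r(2), of x] by simp
    then have "\<rho>\<^sup>2 \<le> 4 / pi * ?m"
      by (simp add: r(1) field_simps)
    then show ?thesis
      by (rule real_le_rsqrt)
  qed
  \<comment> \<open>The degenerate disc of radius 0 makes the supremum that of a nonempty set.\<close>
  obtain x where "x \<in> T" using assms(1) by blast
  then have "0 \<in> ?R"
    by (intro CollectI exI[of _ 0] exI[of _ x]) auto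
  moreover have "bdd_above ?R"
    using bound by (rule bdd_aboveI)
  ultimately show nonneg: "0 \<le> inball_diameter T"
    unfolding inball_diameter_def by (intro cSup_upper)
  have "inball_diameter T \<le> sqrt (4 / pi * ?m)"
    unfolding inball_diameter_def using \<open>0 \<in> ?R\<close> by (intro cSup_least bound) blast+
  then have "(inball_diameter T)\<^sup>2 \<le> (sqrt (4 / pi * ?m))\<^sup>2"
    using nonneg by (intro power_mono)
  then show "(inball_diameter T)\<^sup>2 \<le> 4 / pi * ?m"
    by simp
qed

section \<open>Consequences of the mesh assumptions\<close>

lemma sbm_settingD:
  assumes "sbm_setting \<sigma> \<kappa> C0 CD S"
  shows sbm_open_Dom: "open (Dom S)"
    and sbm_Dom_nonempty: "Dom S \<noteq> {}"
    and sbm_Dom_subset_Box: "closure (Dom S) \<subseteq> Box S"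
    and sbm_admissible: "admissible_mesh (Box S) (Mesh S)"
    and sbm_shape_regular: "shape_regular \<sigma> (Mesh S)"
    and sbm_quasi_uniform: "quasi_uniform \<kappa> (Mesh S)"
    and sbm_two_edges_at_node: "\<forall>a\<in>surr_nodes S. card (edges_at S a) = 2"
    and sbm_distance: "\<forall>x\<in>frontier (surr_dom S). norm (Proj S x - x) \<le> C0 * mesh_size (Mesh S)"
    and sbm_tiling: "(\<Union>e\<in>surr_edges S. gap_elem S e) = closure (Dom S) - surr_dom S"
    and sbm_jac_bound: "\<forall>e\<in>surr_edges S. \<bar>jac S e\<bar> \<le> CD"
    and sbm_Proj_edge_lipschitz: "\<forall>e\<in>surr_edges S. \<exists>L. L-lipschitz_on e (Proj S)"
  using assms unfolding sbm_setting_def by - ((assumption | erule conjE)+, blast)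

lemma
  assumes "sbm_setting \<sigma> \<kappa> C0 CD S"
  shows mesh_simplex: "T \<in> Mesh S \<Longrightarrow> 2 simplex T"
    and finite_mesh: "finite (Mesh S)"
    and mesh_Int_face: "T \<in> Mesh S \<Longrightarrow> T' \<in> Mesh S \<Longrightarrow> T \<inter> T' face_of T"
    and mesh_nonempty: "Mesh S \<noteq> {}"
    and bounded_Dom: "bounded (Dom S)"
proof -
  have *: "admissible_mesh (Box S) (Mesh S)" "closure (Dom S) \<subseteq> Box S" "Dom S \<noteq> {}"
    using assms by (rule sbm_settingD)+
  then show simplex: "\<And>T. T \<in> Mesh S \<Longrightarrow> 2 simplex T" and fin: "finite (Mesh S)"
    and "T \<in> Mesh S \<Longrightarrow> T' \<in> Mesh S \<Longrightarrow> T \<inter> T' face_of T"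
    by (auto simp: admissible_mesh_def triangulation_def)
  have Dom_sub: "Dom S \<subseteq> \<Union>(Mesh S)"
    using * closure_subset[of "Dom S"] by (auto simp: admissible_mesh_def)
  then show "Mesh S \<noteq> {}"
    using *(3) by auto
  have "bounded (\<Union>(Mesh S))"
    using fin simplex
    by (intro bounded_Union) (auto intro!: polytope_imp_bounded simplex_imp_polytope)
  then show "bounded (Dom S)"
    using Dom_sub bounded_subset by blast
qed

lemma mesh_element_bounded:
  assumes "sbm_setting \<sigma> \<kappa> C0 CD S" "T \<in> Mesh S"
  shows "bounded T"
  using mesh_simplex[OF assms] by (simp add: polytope_imp_bounded simplex_imp_polytope)

lemma diameter_le_mesh_size:
  assumes "sbm_setting \<sigma> \<kappa> C0 CD S" "T \<in> Mesh S"
  shows "diameter T \<le> mesh_size (Mesh S)"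
  using finite_mesh[OF assms(1)] assms(2) by (auto simp: mesh_size_def)

lemma mesh_element_nontrivial:
  assumes "sbm_setting \<sigma> \<kappa> C0 CD S" "T \<in> Mesh S"
  shows "T \<noteq> {}" and "diameter T > 0"
proof -
  have dim: "aff_dim T = 2"
    using mesh_simplex[OF assms] aff_dim_simplex by blast
  then show ne: "T \<noteq> {}" by auto
  then obtain x where x: "x \<in> T" by blast
  have "T \<noteq> {x}" using dim by auto
  then obtain y where "y \<in> T" "x \<noteq> y" using x by blast
  with x have "dist x y \<le> diameter T" "dist x y > 0"
    using diameter_bounded_bound[OF mesh_element_bounded[OF assms]] by auto
  then show "diameter T > 0" by linarith
qed

lemma mesh_size_pos:
  assumes "sbm_setting \<sigma> \<kappa> C0 CD S"
  shows "mesh_size (Mesh S) > 0"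
proof -
  obtain T where "T \<in> Mesh S" using mesh_nonempty[OF assms] by blast
  then show ?thesis
    using mesh_element_nontrivial(2)[OF assms] diameter_le_mesh_size[OF assms] by force
qed

text \<open>Quasi-uniformity compares \<open>h\<close> with the diameter of every single element, and shape regularity
  compares that diameter with the inscribed discs.\<close>

lemma mesh_size_sq_le_area:
  assumes S: "sbm_setting \<sigma> \<kappa> C0 CD S" and T: "T \<in> Mesh S"
  shows "(mesh_size (Mesh S))\<^sup>2 \<le> 4 * (\<kappa> * \<sigma>)\<^sup>2 / pi * measure lborel (interior T)"
proof -
  let ?h = "mesh_size (Mesh S)"
  have h: "?h > 0" by (rule mesh_size_pos[OF S])
  have quasi: "?h \<le> \<kappa> * diameter T" and shape: "diameter T \<le> \<sigma> * inball_diameter T"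
    using sbm_quasi_uniform[OF S] sbm_shape_regular[OF S] T
    by (auto simp: quasi_uniform_def shape_regular_def)
  have "\<kappa> > 0"
    using quasi h mesh_element_nontrivial(2)[OF S T] by (metis less_le_trans zero_less_mult_pos2)
  then have "?h \<le> \<kappa> * \<sigma> * inball_diameter T"
    using order_trans[OF quasi mult_left_mono[OF shape, of \<kappa>]] by (simp add: mult.assoc)
  then have "?h\<^sup>2 \<le> (\<kappa> * \<sigma> * inball_diameter T)\<^sup>2"
    using h by (intro power_mono) auto
  also have "\<dots> = (\<kappa> * \<sigma>)\<^sup>2 * (inball_diameter T)\<^sup>2"
    by (simp add: power_mult_distrib)
  also have "\<dots> \<le> (\<kappa> * \<sigma>)\<^sup>2 * (4 / pi * measure lborel (interior T))"
    using inball_diameter_sq_le_area(2)[OF mesh_element_nontrivial(1)[OF S T]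
        mesh_element_bounded[OF S T]]
    by (intro mult_left_mono) auto
  finally show ?thesis by (simp add: field_simps)
qed

lemma surr_meshD: "T \<in> surr_mesh S \<Longrightarrow> T \<in> Mesh S"
  by (simp add: surr_mesh_def)

lemma finite_surr_mesh: "sbm_setting \<sigma> \<kappa> C0 CD S \<Longrightarrow> finite (surr_mesh S)"
  using finite_mesh by (auto intro: finite_subset[of _ "Mesh S"] dest: surr_meshD)

text \<open>The intersection of two elements is a face of each, and a proper face misses the interior.\<close>

lemma disjoint_interiors_mesh:
  assumes S: "sbm_setting \<sigma> \<kappa> C0 CD S" and T: "T \<in> Mesh S" "T' \<in> Mesh S" "T \<noteq> T'"
  shows "interior T \<inter> interior T' = {}"
proof -
  have *: "interior A \<inter> interior B = {}" if "A \<in> Mesh S" "B \<in> Mesh S" "\<not> A \<subseteq> B" for A B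
  proof -
    have "(A \<inter> B) \<inter> interior A = {}"
      using that by (intro face_of_disjoint_interior mesh_Int_face[OF S]) auto
    then show ?thesis
      using interior_subset by blast
  qed
  show ?thesis
    using *[OF T(1,2)] *[OF T(2,1)] T(3) by blast
qed

lemma attached_edge:
  assumes "e \<in> surr_edges S"
  shows "attached S e \<in> surr_mesh S" and "e edge_of attached S e"
proof -
  have "\<exists>T. T \<in> surr_mesh S \<and> e edge_of T"
    using assms by (auto simp: surr_edges_def)
  then have "attached S e \<in> surr_mesh S \<and> e edge_of attached S e"
    unfolding attached_def by (rule someI_ex)
  then show "attached S e \<in> surr_mesh S" and "e edge_of attached S e" by auto
qed

lemma finite_surr_edges:
  assumes "sbm_setting \<sigma> \<kappa> C0 CD S"
  shows "finite (surr_edges S)"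
proof (rule finite_subset)
  show "surr_edges S \<subseteq> (\<Union>T\<in>surr_mesh S. {F. F face_of T})"
    by (auto simp: surr_edges_def edge_of_def)
  show "finite (\<Union>T\<in>surr_mesh S. {F. F face_of T})"
    using finite_surr_mesh[OF assms] simplex_faces(1) mesh_simplex[OF assms] surr_meshD by blast
qed

lemma surr_edge_segment:
  assumes "sbm_setting \<sigma> \<kappa> C0 CD S" "e \<in> surr_edges S"
  obtains a b where "e = closed_segment a b"
  using edge_of_simplex_is_segment attached_edge[OF assms(2)] mesh_simplex[OF assms(1)] surr_meshD
  by metis

lemma surr_edge_length:
  assumes S: "sbm_setting \<sigma> \<kappa> C0 CD S" and e: "e \<in> surr_edges S" "e = closed_segment a b"
  shows "dist a b \<le> mesh_size (Mesh S)"
proof -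
  have T: "attached S e \<in> Mesh S" and "e \<subseteq> attached S e"
    using attached_edge[OF e(1)] by (auto simp: surr_meshD edge_of_imp_subset)
  then have "a \<in> attached S e" "b \<in> attached S e"
    using e(2) by auto
  then have "dist a b \<le> diameter (attached S e)"
    by (rule diameter_bounded_bound[OF mesh_element_bounded[OF S T]])
  also have "\<dots> \<le> mesh_size (Mesh S)"
    by (rule diameter_le_mesh_size[OF S T])
  finally show ?thesis .
qed

lemma surr_edge_endpoints:
  assumes "sbm_setting \<sigma> \<kappa> C0 CD S" "e \<in> surr_edges S"
  shows "finite {a. a extreme_point_of e}" and "card {a. a extreme_point_of e} \<le> 2"
proof -
  obtain a b where "e = closed_segment a b"
    using surr_edge_segment[OF assms] .
  then have "{a. a extreme_point_of e} = {a, b}"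
    by (auto simp: extreme_point_of_segment)
  then show "finite {a. a extreme_point_of e}" and "card {a. a extreme_point_of e} \<le> 2"
    by (auto simp: card_insert_if)
qed

lemma surr_nodes_eq: "surr_nodes S = (\<Union>e\<in>surr_edges S. {a. a extreme_point_of e})"
  by (auto simp: surr_nodes_def)

lemma finite_surr_nodes:
  assumes "sbm_setting \<sigma> \<kappa> C0 CD S"
  shows "finite (surr_nodes S)"
  unfolding surr_nodes_eq using finite_surr_edges[OF assms] surr_edge_endpoints(1)[OF assms] by blast

lemma side_length:
  assumes S: "sbm_setting \<sigma> \<kappa> C0 CD S" and a: "a \<in> surr_nodes S"
  shows "dist a (Proj S a) \<le> C0 * mesh_size (Mesh S)"
proof -
  obtain e where "e \<in> surr_edges S" "a \<in> e"
    using a by (auto simp: surr_nodes_def extreme_point_of_def)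
  then have "a \<in> frontier (surr_dom S)"
    by (auto simp: surr_edges_def)
  then show ?thesis
    using sbm_distance[OF S] by (simp add: dist_norm norm_minus_commute)
qed

lemma dir_edges_subset: "dir_edges S \<subseteq> surr_edges S"
  by (auto simp: dir_edges_def)

lemma jac_nonneg: "0 \<le> jac S e"
  by (simp add: jac_def curve_len_def)

lemma jac_le: "sbm_setting \<sigma> \<kappa> C0 CD S \<Longrightarrow> e \<in> surr_edges S \<Longrightarrow> jac S e \<le> CD"
  using sbm_jac_bound by force

lemma continuous_on_Proj_edge:
  assumes "sbm_setting \<sigma> \<kappa> C0 CD S" "e \<in> surr_edges S"
  shows "continuous_on e (Proj S)"
  using sbm_Proj_edge_lipschitz[OF assms(1)] assms(2) lipschitz_on_continuous_on by blast

lemma norm_outward_normal_le: "norm (outward_normal A x) \<le> 1"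
proof (cases "\<exists>\<nu>. is_outward_normal A x \<nu>")
  case True
  then have "is_outward_normal A x (outward_normal A x)"
    unfolding outward_normal_def by (auto intro: someI_ex)
  then show ?thesis by (simp add: is_outward_normal_def)
qed (auto simp: outward_normal_def)

section \<open>Gap elements and the piecewise gradient\<close>

lemma compact_gap_boundary:
  assumes S: "sbm_setting \<sigma> \<kappa> C0 CD S" and e: "e \<in> surr_edges S"
  shows "compact (gap_boundary S e)"
proof -
  obtain a b where ab: "e = closed_segment a b"
    using surr_edge_segment[OF S e] .
  have "compact (Proj S ` e)"
    using continuous_on_Proj_edge[OF S e] ab by (intro compact_continuous_image) auto
  then show ?thesis
    unfolding gap_boundary_def using surr_edge_endpoints(1)[OF S e] ab
    by (intro compact_Un compact_UN) auto
qed

text \<open>The boundary curve is compact, and the inside of a closed set is open.\<close>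

lemma gap_elem_measurable:
  assumes "sbm_setting \<sigma> \<kappa> C0 CD S" "e \<in> surr_edges S"
  shows "gap_elem S e \<in> sets lborel" and "bounded (gap_elem S e)"
proof -
  have *: "compact (gap_boundary S e)"
    by (rule compact_gap_boundary[OF assms])
  show "gap_elem S e \<in> sets lborel"
    unfolding gap_elem_def sets_lborel using *
    by (intro sets.Un borel_compact borel_open open_inside compact_imp_closed)
  show "bounded (gap_elem S e)"
    unfolding gap_elem_def using * by (auto intro: bounded_inside compact_imp_bounded)
qed

lemma gap_elem_disjoint_surr_dom:
  assumes "sbm_setting \<sigma> \<kappa> C0 CD S" "e \<in> surr_edges S"
  shows "gap_elem S e \<inter> surr_dom S = {}"
  using sbm_tiling[OF assms(1)] assms(2) by blast

lemma Dom_subset_surr_dom_gaps: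
  assumes "sbm_setting \<sigma> \<kappa> C0 CD S"
  shows "Dom S \<subseteq> surr_dom S \<union> (\<Union>e\<in>surr_edges S. gap_elem S e)"
  using sbm_tiling[OF assms] closure_subset[of "Dom S"] by auto

lemma bounded_surr_dom:
  assumes "sbm_setting \<sigma> \<kappa> C0 CD S"
  shows "bounded (surr_dom S)"
proof -
  have "bounded (\<Union>(surr_mesh S))"
    using finite_surr_mesh[OF assms] mesh_element_bounded[OF assms] surr_meshD by blast
  then show ?thesis
    by (simp add: surr_dom_def bounded_interior)
qed

lemma interior_subset_surr_dom: "T \<in> surr_mesh S \<Longrightarrow> interior T \<subseteq> surr_dom S"
  unfolding surr_dom_def by (rule interior_mono) blast

text \<open>Gap elements lie outside the surrogate domain, so that only the summand of the element itself
  survives in the definition of the piecewise gradient.\<close>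

lemma pw_grad_on_element:
  assumes S: "sbm_setting \<sigma> \<kappa> C0 CD S" and T: "T \<in> surr_mesh S" and x: "x \<in> interior T"
  shows "pw_grad S v x = elem_grad S v T"
proof -
  have gap: "x \<notin> interior (gap_elem S e)" if "e \<in> surr_edges S" for e
    using gap_elem_disjoint_surr_dom[OF S that] interior_subset_surr_dom[OF T] x
      interior_subset[of "gap_elem S e"] by blast
  have other: "x \<notin> interior T'" if "T' \<in> surr_mesh S" "T' \<noteq> T" for T'
    using disjoint_interiors_mesh[OF S, of T T'] surr_meshD T that x by blast
  have "pw_grad S v x
      = (\<Sum>T'\<in>surr_mesh S. indicat_real (interior T') x *\<^sub>R elem_grad S v T')"
    using gap by (simp add: pw_grad_def)
  also have "\<dots> = (\<Sum>T'\<in>{T}. indicat_real (interior T') x *\<^sub>R elem_grad S v T')"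
    using other finite_surr_mesh[OF S] T by (intro sum.mono_neutral_right) auto
  finally show ?thesis
    using x by simp
qed

lemma pw_grad_measurable: "pw_grad S v \<in> borel_measurable borel"
  unfolding pw_grad_def by measurable

lemma pw_grad_bounded: "\<exists>B. \<forall>x. norm (pw_grad S v x) \<le> B"
proof (intro exI allI)
  fix x
  have *: "norm (indicat_real A x *\<^sub>R g) \<le> norm g" for A :: "pt set" and g :: pt
    by (auto simp: indicator_def)
  show "norm (pw_grad S v x)
      \<le> (\<Sum>T\<in>surr_mesh S. norm (elem_grad S v T)) + (\<Sum>e\<in>surr_edges S. norm (ext_grad S v e))"
    unfolding pw_grad_def
    by (intro norm_triangle_le add_mono sum_norm_le *)
qed

lemma pw_grad_sq_integrable:
  assumes "A \<in> sets lborel" "bounded A"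
  shows "set_integrable lborel A (\<lambda>x. (norm (pw_grad S v x))\<^sup>2)"
proof -
  obtain B where B: "\<And>x. norm (pw_grad S v x) \<le> B"
    using pw_grad_bounded by blast
  have [measurable]: "A \<in> sets borel" "pw_grad S v \<in> borel_measurable borel"
    using assms(1) pw_grad_measurable by auto
  show ?thesis
    unfolding set_integrable_def
  proof (rule integrableI_bounded_set[of A _ _ "B\<^sup>2"])
    show "emeasure lborel A < \<infinity>"
      by (rule emeasure_bounded_finite[OF assms(2)])
    show "AE x in lborel. x \<in> A \<longrightarrow> norm (indicat_real A x *\<^sub>R (norm (pw_grad S v x))\<^sup>2) \<le> B\<^sup>2"
      using B by (auto intro!: power_mono)
  qed auto
qed

text \<open>The pieces cover the domain. Their overlaps, and the parts of gap elements on the boundary of the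
  domain, can only increase the right-hand side.\<close>

lemma h1_seminorm_le_parts:
  assumes S: "sbm_setting \<sigma> \<kappa> C0 CD S"
  shows "h1_seminorm_sq S v \<le> (LINT x:surr_dom S|lborel. (norm (pw_grad S v x))\<^sup>2)
      + (\<Sum>e\<in>surr_edges S. LINT x:gap_elem S e|lborel. (norm (pw_grad S v x))\<^sup>2)"
proof -
  let ?f = "\<lambda>x. (norm (pw_grad S v x))\<^sup>2"
  let ?g = "\<lambda>A x. indicat_real A x *\<^sub>R ?f x"
  have int: "integrable lborel (?g A)" if "A \<in> sets lborel" "bounded A" for A
    using pw_grad_sq_integrable[OF that] by (simp add: set_integrable_def)
  have iD: "integrable lborel (?g (Dom S))"
    using sbm_open_Dom[OF S] bounded_Dom[OF S] by (intro int) auto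
  have iS: "integrable lborel (?g (surr_dom S))"
    using bounded_surr_dom[OF S] by (intro int) (auto simp: surr_dom_def)
  have iG: "integrable lborel (?g (gap_elem S e))" if "e \<in> surr_edges S" for e
    using gap_elem_measurable[OF S that] by (intro int)
  have "(LINT x|lborel. ?g (Dom S) x)
      \<le> (LINT x|lborel. ?g (surr_dom S) x + (\<Sum>e\<in>surr_edges S. ?g (gap_elem S e) x))"
  proof (rule integral_mono)
    show "integrable lborel (\<lambda>x. ?g (surr_dom S) x + (\<Sum>e\<in>surr_edges S. ?g (gap_elem S e) x))"
      using iS iG by auto
    fix x
    have nonneg: "0 \<le> (\<Sum>e\<in>surr_edges S. ?g (gap_elem S e) x)"
      by (intro sum_nonneg) auto
    show "?g (Dom S) x \<le> ?g (surr_dom S) x + (\<Sum>e\<in>surr_edges S. ?g (gap_elem S e) x)"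
    proof (cases "x \<in> Dom S \<and> x \<notin> surr_dom S")
      case True
      then obtain e where e: "e \<in> surr_edges S" "x \<in> gap_elem S e"
        using Dom_subset_surr_dom_gaps[OF S] by blast
      have "?g (gap_elem S e) x \<le> (\<Sum>e\<in>surr_edges S. ?g (gap_elem S e) x)"
        using e(1) finite_surr_edges[OF S] by (intro member_le_sum) auto
      then show ?thesis using e True by simp
    qed (use nonneg in \<open>auto simp: indicator_def\<close>)
  qed (rule iD)
  also have "\<dots> = (LINT x|lborel. ?g (surr_dom S) x)
      + (\<Sum>e\<in>surr_edges S. LINT x|lborel. ?g (gap_elem S e) x)"
    using iS iG by (subst Bochner_Integration.integral_add) (auto simp: Bochner_Integration.integral_sum)
  finally show ?thesis
    by (simp add: h1_seminorm_sq_def set_lebesgue_integral_def)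
qed

lemma sum_element_energy_le:
  assumes S: "sbm_setting \<sigma> \<kappa> C0 CD S"
  shows "(\<Sum>T\<in>surr_mesh S. measure lborel (interior T) * (norm (elem_grad S v T))\<^sup>2)
      \<le> (LINT x:surr_dom S|lborel. (norm (pw_grad S v x))\<^sup>2)"
proof -
  let ?f = "\<lambda>x. (norm (pw_grad S v x))\<^sup>2"
  let ?g = "\<lambda>T x. indicat_real (interior T) x * (norm (elem_grad S v T))\<^sup>2"
  have fin: "emeasure lborel (interior T) < \<infinity>" if "T \<in> surr_mesh S" for T
    using mesh_element_bounded[OF S surr_meshD[OF that]]
    by (intro emeasure_bounded_finite bounded_interior)
  have int: "integrable lborel (?g T)" if "T \<in> surr_mesh S" for T
    using fin[OF that] by (intro integrable_mult_left integrable_real_indicator) auto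
  have "(\<Sum>T\<in>surr_mesh S. measure lborel (interior T) * (norm (elem_grad S v T))\<^sup>2)
      = (LINT x|lborel. (\<Sum>T\<in>surr_mesh S. ?g T x))"
    using int by (subst Bochner_Integration.integral_sum) auto
  also have "\<dots> \<le> (LINT x|lborel. indicat_real (surr_dom S) x *\<^sub>R ?f x)"
  proof (rule integral_mono)
    show "integrable lborel (\<lambda>x. \<Sum>T\<in>surr_mesh S. ?g T x)"
      using int by auto
    show "integrable lborel (\<lambda>x. indicat_real (surr_dom S) x *\<^sub>R ?f x)"
      using pw_grad_sq_integrable[of "surr_dom S" S v] bounded_surr_dom[OF S]
      by (auto simp: set_integrable_def surr_dom_def)
    fix x
    show "(\<Sum>T\<in>surr_mesh S. ?g T x) \<le> indicat_real (surr_dom S) x *\<^sub>R ?f x"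
    proof (cases "\<exists>T\<in>surr_mesh S. x \<in> interior T")
      case True
      then obtain T where T: "T \<in> surr_mesh S" "x \<in> interior T" by blast
      have "(\<Sum>T'\<in>surr_mesh S. ?g T' x) = (\<Sum>T'\<in>{T}. ?g T' x)"
        using disjoint_interiors_mesh[OF S surr_meshD surr_meshD, of T] T finite_surr_mesh[OF S]
        by (intro sum.mono_neutral_right) (auto simp: indicator_def)
      then show ?thesis
        using T pw_grad_on_element[OF S T, of v] interior_subset_surr_dom[OF T(1)]
        by (auto simp: indicator_def)
    next
      case False
      then have "(\<Sum>T\<in>surr_mesh S. ?g T x) = 0"
        by (intro sum.neutral) auto
      then show ?thesis by simp
    qed
  qed
  finally show ?thesis by (simp add: set_lebesgue_integral_def)
qed

text \<open>The step that replaces a trace inequality: gradients seen from the gap are controlled by the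
  energy on the surrogate domain. The constant is 8, the bound on the number of faces of a triangle,
  times the constant \<open>4 (\<kappa> \<sigma>)\<^sup>2 / \<pi>\<close> in the comparison of \<open>h\<^sup>2\<close> with areas.\<close>

lemma sum_edge_gradients_le:
  assumes S: "sbm_setting \<sigma> \<kappa> C0 CD S"
  shows "(mesh_size (Mesh S))\<^sup>2 * (\<Sum>e\<in>surr_edges S. (norm (ext_grad S v e))\<^sup>2)
      \<le> 32 * (\<kappa> * \<sigma>)\<^sup>2 / pi * (LINT x:surr_dom S|lborel. (norm (pw_grad S v x))\<^sup>2)"
proof -
  let ?h = "mesh_size (Mesh S)"
  let ?m = "4 * (\<kappa> * \<sigma>)\<^sup>2 / pi"
  let ?g = "\<lambda>T. (norm (elem_grad S v T))\<^sup>2"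
  have "(\<Sum>e\<in>surr_edges S. (norm (ext_grad S v e))\<^sup>2)
      = (\<Sum>T\<in>surr_mesh S. \<Sum>e | e \<in> surr_edges S \<and> attached S e = T. ?g (attached S e))"
    unfolding ext_grad_def using finite_surr_edges[OF S] finite_surr_mesh[OF S]
    by (intro sum.group[symmetric]) (auto simp: attached_edge)
  also have "\<dots> = (\<Sum>T\<in>surr_mesh S. card {e \<in> surr_edges S. attached S e = T} * ?g T)"
    by (intro sum.cong) auto
  also have "\<dots> \<le> (\<Sum>T\<in>surr_mesh S. 8 * ?g T)"
  proof (intro sum_mono mult_right_mono)
    fix T assume T: "T \<in> surr_mesh S"
    have simp: "2 simplex T"
      using T mesh_simplex[OF S] surr_meshD by blast
    have "card {e \<in> surr_edges S. attached S e = T} \<le> card {F. F face_of T}"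
      using simplex_faces(1)[OF simp] attached_edge(2)
      by (intro card_mono) (auto simp: edge_of_def)
    also have "\<dots> \<le> 8"
      by (rule simplex_faces(2)[OF simp])
    finally show "real (card {e \<in> surr_edges S. attached S e = T}) \<le> 8"
      by simp
  qed auto
  finally have "?h\<^sup>2 * (\<Sum>e\<in>surr_edges S. (norm (ext_grad S v e))\<^sup>2)
      \<le> ?h\<^sup>2 * (\<Sum>T\<in>surr_mesh S. 8 * ?g T)"
    by (intro mult_left_mono) auto
  also have "\<dots> = (\<Sum>T\<in>surr_mesh S. 8 * (?h\<^sup>2 * ?g T))"
    by (simp add: sum_distrib_left mult_ac)
  also have "\<dots> \<le> (\<Sum>T\<in>surr_mesh S. 8 * (?m * measure lborel (interior T) * ?g T))"
    by (intro sum_mono mult_left_mono mult_right_mono mesh_size_sq_le_area[OF S])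
       (auto simp: surr_meshD)
  also have "\<dots> = 8 * ?m * (\<Sum>T\<in>surr_mesh S. measure lborel (interior T) * ?g T)"
    by (simp add: sum_distrib_left mult_ac)
  also have "\<dots> \<le> 8 * ?m * (LINT x:surr_dom S|lborel. (norm (pw_grad S v x))\<^sup>2)"
    by (intro mult_left_mono sum_element_energy_le[OF S]) auto
  finally show ?thesis by simp
qed

section \<open>The consistency terms\<close>

lemma continuous_on_jump: "continuous_on A (jump S v a)"
  unfolding jump_def ext_val_def elem_poly_def by (intro continuous_intros)

lemma norm_avg_grad_sq_le:
  assumes "card (edges_at S a) = 2"
  shows "(norm (avg_grad S v a))\<^sup>2 \<le> 1/2 * (\<Sum>e\<in>edges_at S a. (norm (ext_grad S v e))\<^sup>2)"
proof -
  obtain e e' where e: "edges_at S a = {e, e'}" "e \<noteq> e'"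
    using assms by (meson card_2_iff)
  let ?x = "ext_grad S v e" and ?y = "ext_grad S v e'"
  have "norm (?x + ?y) \<le> norm ?x + norm ?y"
    by (rule norm_triangle_ineq)
  then have "(norm (?x + ?y))\<^sup>2 \<le> (norm ?x + norm ?y)\<^sup>2"
    by (intro power_mono) auto
  also have "\<dots> \<le> 2 * ((norm ?x)\<^sup>2 + (norm ?y)\<^sup>2)"
    using sum_squares_bound[of "norm ?x" "norm ?y"] by (simp add: power2_sum)
  finally show ?thesis
    using e by (simp add: avg_grad_def power_divide)
qed

text \<open>After an exchange of the sums, every edge is counted once for each of its two endpoints.\<close>

lemma sum_nodes_edges_le:
  fixes f :: "pt set \<Rightarrow> real"
  assumes S: "sbm_setting \<sigma> \<kappa> C0 CD S" and f: "\<And>e. 0 \<le> f e"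
  shows "(\<Sum>a\<in>surr_nodes S. \<Sum>e\<in>edges_at S a. f e) \<le> 2 * (\<Sum>e\<in>surr_edges S. f e)"
proof -
  have "(\<Sum>a\<in>surr_nodes S. \<Sum>e\<in>edges_at S a. f e)
      = (\<Sum>e\<in>surr_edges S. \<Sum>a | a \<in> surr_nodes S \<and> a extreme_point_of e. f e)"
    unfolding edges_at_def
    by (rule sum.swap_restrict[OF finite_surr_nodes[OF S] finite_surr_edges[OF S]])
  also have "\<dots> \<le> (\<Sum>e\<in>surr_edges S. 2 * f e)"
  proof (rule sum_mono)
    fix e assume e: "e \<in> surr_edges S"
    have "card {a. a \<in> surr_nodes S \<and> a extreme_point_of e} \<le> card {a. a extreme_point_of e}"
      using surr_edge_endpoints(1)[OF S e] by (intro card_mono) auto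
    also have "\<dots> \<le> 2"
      by (rule surr_edge_endpoints(2)[OF S e])
    finally have "real (card {a. a \<in> surr_nodes S \<and> a extreme_point_of e}) \<le> 2"
      by simp
    then show "(\<Sum>a | a \<in> surr_nodes S \<and> a extreme_point_of e. f e) \<le> 2 * f e"
      using f by (simp add: mult_right_mono)
  qed
  finally show ?thesis by (simp add: sum_distrib_left)
qed

text \<open>The average gradient is constant on the segment from a node to its image, whose length is at most
  \<open>C\<^sub>0 h\<close>; together with the Young weight \<open>\<delta> h\<close> this yields the factor \<open>h\<^sup>2\<close>. The absolute value
  of \<open>C\<^sub>0\<close> keeps the remainder nonnegative if there is no node to force \<open>C\<^sub>0 \<ge> 0\<close>.\<close>

lemma jump_consistency_le:
  assumes S: "sbm_setting \<sigma> \<kappa> C0 CD S" and \<delta>: "\<delta> > 0"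
  defines "h \<equiv> mesh_size (Mesh S)"
  shows "\<bar>side_integral S (\<lambda>a x. jump S v a x \<bullet> avg_grad S v a)\<bar>
      \<le> 1 / (2 * \<delta>) * (1 / h * side_integral S (\<lambda>a x. (norm (jump S v a x))\<^sup>2))
        + \<delta> / 2 * \<bar>C0\<bar> * (h\<^sup>2 * (\<Sum>e\<in>surr_edges S. (norm (ext_grad S v e))\<^sup>2))"
proof -
  have h: "h > 0" unfolding h_def by (rule mesh_size_pos[OF S])
  let ?J = "\<lambda>a. seg_integral a (Proj S a) (\<lambda>x. (norm (jump S v a x))\<^sup>2)"
  let ?g = "\<lambda>a. \<Sum>e\<in>edges_at S a. (norm (ext_grad S v e))\<^sup>2"
  have node: "\<bar>seg_integral a (Proj S a) (\<lambda>x. jump S v a x \<bullet> avg_grad S v a)\<bar>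
      \<le> 1 / (2 * (\<delta> * h)) * ?J a + \<delta> / 4 * \<bar>C0\<bar> * h\<^sup>2 * ?g a"
    if a: "a \<in> surr_nodes S" for a
  proof -
    have "\<bar>seg_integral a (Proj S a) (\<lambda>x. jump S v a x \<bullet> avg_grad S v a)\<bar>
      \<le> 1 / (2 * (\<delta> * h)) * ?J a + dist a (Proj S a) * (\<delta> * h / 2 * (norm (avg_grad S v a))\<^sup>2)"
    proof (rule abs_seg_integral_le)
      show "continuous_on (closed_segment a (Proj S a)) (\<lambda>x. (norm (jump S v a x))\<^sup>2)"
        by (intro continuous_intros continuous_on_jump)
      show "\<bar>jump S v a x \<bullet> avg_grad S v a\<bar> \<le> 1 / (2 * (\<delta> * h)) * (norm (jump S v a x))\<^sup>2
          + \<delta> * h / 2 * (norm (avg_grad S v a))\<^sup>2" for x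
        using inner_le_young[of "\<delta> * h"] \<delta> h by simp
    qed
    also have "dist a (Proj S a) * (\<delta> * h / 2 * (norm (avg_grad S v a))\<^sup>2)
        \<le> (\<bar>C0\<bar> * h) * (\<delta> * h / 2 * (1/2 * ?g a))"
    proof (intro mult_mono)
      have "dist a (Proj S a) \<le> C0 * h"
        using side_length[OF S a] by (simp add: h_def)
      also have "\<dots> \<le> \<bar>C0\<bar> * h"
        using h by (intro mult_right_mono) auto
      finally show "dist a (Proj S a) \<le> \<bar>C0\<bar> * h" .
      show "(norm (avg_grad S v a))\<^sup>2 \<le> 1/2 * ?g a"
        using sbm_two_edges_at_node[OF S] a by (intro norm_avg_grad_sq_le) blast
    qed (use \<delta> h in auto)
    finally show ?thesis by (simp add: power2_eq_square algebra_simps)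
  qed
  have "\<bar>side_integral S (\<lambda>a x. jump S v a x \<bullet> avg_grad S v a)\<bar>
      \<le> (\<Sum>a\<in>surr_nodes S. 1 / (2 * (\<delta> * h)) * ?J a + \<delta> / 4 * \<bar>C0\<bar> * h\<^sup>2 * ?g a)"
    unfolding side_integral_def by (intro order_trans[OF sum_abs] sum_mono node)
  also have "\<dots> = 1 / (2 * (\<delta> * h)) * (\<Sum>a\<in>surr_nodes S. ?J a)
      + \<delta> / 4 * \<bar>C0\<bar> * h\<^sup>2 * (\<Sum>a\<in>surr_nodes S. ?g a)"
    by (simp add: sum.distrib sum_distrib_left)
  also have "\<dots> \<le> 1 / (2 * (\<delta> * h)) * (\<Sum>a\<in>surr_nodes S. ?J a)
      + \<delta> / 4 * \<bar>C0\<bar> * h\<^sup>2 * (2 * (\<Sum>e\<in>surr_edges S. (norm (ext_grad S v e))\<^sup>2))"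
    using \<delta> by (intro add_left_mono mult_left_mono sum_nodes_edges_le[OF S]) auto
  finally show ?thesis by (simp add: side_integral_def)
qed

lemma continuous_on_shift:
  assumes "sbm_setting \<sigma> \<kappa> C0 CD S" "e \<in> surr_edges S"
  shows "continuous_on e (shift S v e)"
  unfolding shift_def ext_val_def elem_poly_def
  by (intro continuous_intros continuous_on_Proj_edge[OF assms])

text \<open>As for the jumps, with an edge of length at most \<open>h\<close> in place of the segment to the boundary.
  The Jacobian is kept as a weight on the shifted values, where the norm contains it as well, and is
  bounded by \<open>C\<^sub>D\<close> in front of the gradients.\<close>

lemma dirichlet_consistency_le:
  assumes S: "sbm_setting \<sigma> \<kappa> C0 CD S" and \<delta>: "\<delta> > 0"
  defines "h \<equiv> mesh_size (Mesh S)"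
  shows "\<bar>\<Sum>e\<in>dir_edges S. edge_integral e
           (\<lambda>x. shift S v e x * (ext_grad S v e \<bullet> shifted_normal S x * jac S e))\<bar>
      \<le> 1 / (2 * \<delta>) * (1 / h * (\<Sum>e\<in>dir_edges S. edge_integral e (\<lambda>x. (shift S v e x * sqrt (jac S e))\<^sup>2)))
        + \<delta> / 2 * \<bar>CD\<bar> * (h\<^sup>2 * (\<Sum>e\<in>surr_edges S. (norm (ext_grad S v e))\<^sup>2))"
proof -
  have h: "h > 0" unfolding h_def by (rule mesh_size_pos[OF S])
  let ?D = "\<lambda>e. edge_integral e (\<lambda>x. (shift S v e x * sqrt (jac S e))\<^sup>2)"
  let ?g = "\<lambda>e. (norm (ext_grad S v e))\<^sup>2"
  let ?f = "\<lambda>e x. shift S v e x * (ext_grad S v e \<bullet> shifted_normal S x * jac S e)"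
  have edge: "\<bar>edge_integral e (?f e)\<bar> \<le> 1 / (2 * (\<delta> * h)) * ?D e + \<delta> / 2 * \<bar>CD\<bar> * h\<^sup>2 * ?g e"
    if "e \<in> dir_edges S" for e
  proof -
    have e: "e \<in> surr_edges S"
      using that dir_edges_subset by blast
    obtain a b where ab: "e = closed_segment a b"
      and int: "\<And>f. edge_integral e f = seg_integral a b f"
      using surr_edge_segment[OF S e] edge_integral_eq_seg_integral by metis
    let ?j = "jac S e"
    have "\<bar>seg_integral a b (?f e)\<bar>
      \<le> 1 / (2 * (\<delta> * h)) * seg_integral a b (\<lambda>x. (shift S v e x * sqrt ?j)\<^sup>2)
        + dist a b * (?j * (\<delta> * h / 2 * ?g e))"
    proof (rule abs_seg_integral_le)
      show "continuous_on (closed_segment a b) (\<lambda>x. (shift S v e x * sqrt ?j)\<^sup>2)"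
        using continuous_on_shift[OF S e] ab by (intro continuous_intros) auto
      fix x
      let ?s = "shift S v e x" and ?n = "shifted_normal S x"
      have "norm ?n \<le> 1"
        by (simp add: shifted_normal_def norm_outward_normal_le)
      then have "(norm (?s *\<^sub>R ?n))\<^sup>2 \<le> ?s\<^sup>2"
        by (simp add: power_mult_distrib mult_left_le power_le_one)
      then have "(norm (?s *\<^sub>R ?n))\<^sup>2 / (2 * (\<delta> * h)) \<le> ?s\<^sup>2 / (2 * (\<delta> * h))"
        using \<delta> h by (intro divide_right_mono) auto
      then have "\<bar>?s *\<^sub>R ?n \<bullet> ext_grad S v e\<bar> \<le> ?s\<^sup>2 / (2 * (\<delta> * h)) + \<delta> * h / 2 * ?g e"
        using inner_le_young[of "\<delta> * h" "?s *\<^sub>R ?n" "ext_grad S v e"] \<delta> h by simp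
      then have "?j * \<bar>?s *\<^sub>R ?n \<bullet> ext_grad S v e\<bar>
          \<le> ?j * (?s\<^sup>2 / (2 * (\<delta> * h)) + \<delta> * h / 2 * ?g e)"
        by (intro mult_left_mono jac_nonneg)
      moreover have "\<bar>?f e x\<bar> = ?j * \<bar>?s *\<^sub>R ?n \<bullet> ext_grad S v e\<bar>"
        using jac_nonneg[of S e] by (simp add: abs_mult inner_commute mult_ac)
      ultimately show "\<bar>?f e x\<bar> \<le> 1 / (2 * (\<delta> * h)) * (?s * sqrt ?j)\<^sup>2 + ?j * (\<delta> * h / 2 * ?g e)"
        using jac_nonneg[of S e] by (simp add: power_mult_distrib algebra_simps)
    qed
    also have "dist a b * (?j * (\<delta> * h / 2 * ?g e)) \<le> h * (\<bar>CD\<bar> * (\<delta> * h / 2 * ?g e))"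
    proof (intro mult_mono)
      show "dist a b \<le> h"
        using surr_edge_length[OF S e ab] by (simp add: h_def)
      show "?j \<le> \<bar>CD\<bar>"
        using jac_le[OF S e] by linarith
    qed (use \<delta> h jac_nonneg in auto)
    finally show ?thesis
      unfolding int by (simp add: power2_eq_square algebra_simps)
  qed
  have "\<bar>\<Sum>e\<in>dir_edges S. edge_integral e (?f e)\<bar>
      \<le> (\<Sum>e\<in>dir_edges S. 1 / (2 * (\<delta> * h)) * ?D e + \<delta> / 2 * \<bar>CD\<bar> * h\<^sup>2 * ?g e)"
    by (intro order_trans[OF sum_abs] sum_mono edge)
  also have "\<dots> = 1 / (2 * (\<delta> * h)) * (\<Sum>e\<in>dir_edges S. ?D e)
      + \<delta> / 2 * \<bar>CD\<bar> * h\<^sup>2 * (\<Sum>e\<in>dir_edges S. ?g e)"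
    by (simp add: sum.distrib sum_distrib_left)
  also have "\<dots> \<le> 1 / (2 * (\<delta> * h)) * (\<Sum>e\<in>dir_edges S. ?D e)
      + \<delta> / 2 * \<bar>CD\<bar> * h\<^sup>2 * (\<Sum>e\<in>surr_edges S. ?g e)"
    using \<delta> finite_surr_edges[OF S] dir_edges_subset
    by (intro add_left_mono mult_left_mono sum_mono2) auto
  finally show ?thesis by simp
qed

section \<open>Coercivity\<close>

lemma seg_integral_nonneg: "(\<And>x. 0 \<le> f x) \<Longrightarrow> 0 \<le> seg_integral a b f"
  unfolding seg_integral_def set_lebesgue_integral_def
  by (intro mult_nonneg_nonneg Bochner_Integration.integral_nonneg) auto

text \<open>For equal arguments the symmetric and the \<open>\<theta>\<close>-weighted consistency terms coincide, whence the
  factor \<open>1 + \<theta>\<close>.\<close>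

lemma a_h_diagonal:
  fixes S :: sbm
  defines "h \<equiv> mesh_size (Mesh S)"
  shows "a_h \<theta> \<gamma> S v v =
     (LINT x:surr_dom S|lborel. (norm (pw_grad S v x))\<^sup>2)
   + (\<Sum>e\<in>surr_edges S. LINT x:gap_elem S e|lborel. (norm (pw_grad S v x))\<^sup>2)
   - (1 + \<theta>) * side_integral S (\<lambda>a x. jump S v a x \<bullet> avg_grad S v a)
   - (1 + \<theta>) * (\<Sum>e\<in>dir_edges S. edge_integral e
        (\<lambda>x. shift S v e x * (ext_grad S v e \<bullet> shifted_normal S x * jac S e)))
   + \<gamma> * (1 / h * side_integral S (\<lambda>a x. (norm (jump S v a x))\<^sup>2))
   + \<gamma> * (1 / h * (\<Sum>e\<in>dir_edges S. edge_integral e (\<lambda>x. (shift S v e x * sqrt (jac S e))\<^sup>2)))"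
proof -
  have 1: "side_integral S (\<lambda>a x. \<gamma> / h * (jump S v a x \<bullet> jump S v a x))
      = \<gamma> * (1 / h * side_integral S (\<lambda>a x. (norm (jump S v a x))\<^sup>2))"
    unfolding side_integral_def seg_integral_cmult
    by (simp add: sum_distrib_left power2_norm_eq_inner)
  have "(\<lambda>x. \<gamma> / h * shift S v e x * (shift S v e x * jac S e))
      = (\<lambda>x. \<gamma> / h * (shift S v e x * sqrt (jac S e))\<^sup>2)" for e
    using jac_nonneg[of S e] by (simp add: fun_eq_iff power_mult_distrib power2_eq_square)
  then have 2: "(\<Sum>e\<in>dir_edges S. edge_integral e (\<lambda>x. \<gamma> / h * shift S v e x * (shift S v e x * jac S e)))
      = \<gamma> * (1 / h * (\<Sum>e\<in>dir_edges S. edge_integral e (\<lambda>x. (shift S v e x * sqrt (jac S e))\<^sup>2)))"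
    by (simp only: edge_integral_cmult) (simp add: sum_distrib_left)
  have 3: "(\<lambda>x. (ext_grad S v e \<bullet> shifted_normal S x) * (shift S v e x * jac S e))
      = (\<lambda>x. shift S v e x * (ext_grad S v e \<bullet> shifted_normal S x * jac S e))" for e
    by (simp add: fun_eq_iff)
  show ?thesis
    unfolding a_h_def Let_def h_def[symmetric] 1 2 3
    by (simp add: power2_norm_eq_inner algebra_simps)
qed

text \<open>The condition \<open>small\<close> says that the gradient remainders of both consistency terms together are
  at most half of the energy on the surrogate domain.\<close>

lemma coercivity:
  assumes S: "sbm_setting \<sigma> \<kappa> C0 CD S" and \<delta>: "\<delta> > 0"
    and small: "\<bar>1 + \<theta>\<bar> * \<delta> * ((\<bar>C0\<bar> + \<bar>CD\<bar>) * (32 * (\<kappa> * \<sigma>)\<^sup>2 / pi)) \<le> 1"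
    and \<gamma>: "\<gamma> \<ge> 1/2 + \<bar>1 + \<theta>\<bar> / (2 * \<delta>)"
  shows "a_h \<theta> \<gamma> S v v \<ge> 1/2 * triple_norm_sq S v"
proof -
  define h where "h = mesh_size (Mesh S)"
  define G where "G = (LINT x:surr_dom S|lborel. (norm (pw_grad S v x))\<^sup>2)"
  define E where "E = (\<Sum>e\<in>surr_edges S. LINT x:gap_elem S e|lborel. (norm (pw_grad S v x))\<^sup>2)"
  define J where "J = 1 / h * side_integral S (\<lambda>a x. (norm (jump S v a x))\<^sup>2)"
  define D where "D = 1 / h * (\<Sum>e\<in>dir_edges S. edge_integral e (\<lambda>x. (shift S v e x * sqrt (jac S e))\<^sup>2))"
  define X where "X = side_integral S (\<lambda>a x. jump S v a x \<bullet> avg_grad S v a)"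
  define Y where "Y = (\<Sum>e\<in>dir_edges S. edge_integral e
      (\<lambda>x. shift S v e x * (ext_grad S v e \<bullet> shifted_normal S x * jac S e)))"
  define R where "R = h\<^sup>2 * (\<Sum>e\<in>surr_edges S. (norm (ext_grad S v e))\<^sup>2)"
  let ?t = "\<bar>1 + \<theta>\<bar>" and ?c = "32 * (\<kappa> * \<sigma>)\<^sup>2 / pi"
  have h: "h > 0" unfolding h_def by (rule mesh_size_pos[OF S])
  have a_h: "a_h \<theta> \<gamma> S v v = G + E - (1 + \<theta>) * X - (1 + \<theta>) * Y + \<gamma> * J + \<gamma> * D"
    by (simp only: a_h_diagonal h_def G_def E_def J_def D_def X_def Y_def)
  have norm: "triple_norm_sq S v \<le> G + E + J + D"
    using h1_seminorm_le_parts[OF S, of v]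
    by (simp add: triple_norm_sq_def Let_def h_def G_def E_def J_def D_def)
  have nonneg: "0 \<le> G" "0 \<le> E" "0 \<le> J" "0 \<le> D"
    using h unfolding G_def E_def J_def D_def side_integral_def set_lebesgue_integral_def
    by (auto intro!: divide_nonneg_pos sum_nonneg Bochner_Integration.integral_nonneg seg_integral_nonneg
        simp: edge_integral_def case_prod_unfold Let_def)
  have X: "\<bar>X\<bar> \<le> 1 / (2 * \<delta>) * J + \<delta> / 2 * \<bar>C0\<bar> * R"
    unfolding X_def J_def R_def h_def by (rule jump_consistency_le[OF S \<delta>])
  have Y: "\<bar>Y\<bar> \<le> 1 / (2 * \<delta>) * D + \<delta> / 2 * \<bar>CD\<bar> * R"
    unfolding Y_def D_def R_def h_def by (rule dirichlet_consistency_le[OF S \<delta>])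
  have R: "R \<le> ?c * G"
    unfolding R_def G_def h_def by (rule sum_edge_gradients_le[OF S])
  have "(1 + \<theta>) * X + (1 + \<theta>) * Y \<le> ?t * \<bar>X\<bar> + ?t * \<bar>Y\<bar>"
    by (intro add_mono) (metis abs_ge_self abs_mult)+
  also have "\<dots> \<le> ?t * (1 / (2 * \<delta>) * J + \<delta> / 2 * \<bar>C0\<bar> * R)
      + ?t * (1 / (2 * \<delta>) * D + \<delta> / 2 * \<bar>CD\<bar> * R)"
    by (intro add_mono mult_left_mono X Y) auto
  also have "\<dots> = ?t / (2 * \<delta>) * (J + D) + ?t * \<delta> * (\<bar>C0\<bar> + \<bar>CD\<bar>) / 2 * R"
    by (simp add: algebra_simps add_divide_distrib)
  also have "\<dots> \<le> ?t / (2 * \<delta>) * (J + D) + ?t * \<delta> * (\<bar>C0\<bar> + \<bar>CD\<bar>) / 2 * (?c * G)"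
    using \<delta> by (intro add_left_mono mult_left_mono R) auto
  also have "?t * \<delta> * (\<bar>C0\<bar> + \<bar>CD\<bar>) / 2 * (?c * G) \<le> 1/2 * G"
    using mult_right_mono[OF small nonneg(1)] by (simp add: mult_ac)
  finally have consistency: "(1 + \<theta>) * X + (1 + \<theta>) * Y \<le> ?t / (2 * \<delta>) * (J + D) + 1/2 * G"
    by simp
  have "(1/2 + ?t / (2 * \<delta>)) * (J + D) \<le> \<gamma> * (J + D)"
    using \<gamma> nonneg by (intro mult_right_mono) auto
  then have "1/2 * (J + D) + ?t / (2 * \<delta>) * (J + D) \<le> \<gamma> * J + \<gamma> * D"
    by (simp only: distrib_left distrib_right)
  then show ?thesis
    using a_h norm nonneg consistency by argo
qed

theorem lemma1:
  fixes \<theta> \<sigma> \<kappa> C0 CD :: real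
  shows "\<exists>\<alpha>>0. \<exists>\<gamma>0>0. \<forall>S. sbm_setting \<sigma> \<kappa> C0 CD S \<longrightarrow>
           (\<forall>\<gamma>\<ge>\<gamma>0. \<forall>v\<in>Vh S. a_h \<theta> \<gamma> S v v \<ge> \<alpha> * triple_norm_sq S v)"
proof -
  define K where "K = \<bar>1 + \<theta>\<bar> * ((\<bar>C0\<bar> + \<bar>CD\<bar>) * (32 * (\<kappa> * \<sigma>)\<^sup>2 / pi))"
  \<comment> \<open>The 1 avoids a division by 0 when \<open>\<theta> = - 1\<close> or another factor vanishes.\<close>
  define \<delta> where "\<delta> = 1 / (K + 1)"
  have "K \<ge> 0" by (simp add: K_def)
  then have \<delta>: "\<delta> > 0" "\<delta> * K \<le> 1"
    by (simp_all add: \<delta>_def)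
  have small: "\<bar>1 + \<theta>\<bar> * \<delta> * ((\<bar>C0\<bar> + \<bar>CD\<bar>) * (32 * (\<kappa> * \<sigma>)\<^sup>2 / pi)) \<le> 1"
    using \<delta>(2) by (simp add: K_def mult_ac)
  define \<gamma>0 where "\<gamma>0 = 1/2 + \<bar>1 + \<theta>\<bar> / (2 * \<delta>)"
  have "\<gamma>0 > 0"
    unfolding \<gamma>0_def using \<delta>(1) by (intro add_pos_nonneg) auto
  moreover have "\<forall>S. sbm_setting \<sigma> \<kappa> C0 CD S \<longrightarrow>
      (\<forall>\<gamma>\<ge>\<gamma>0. \<forall>v\<in>Vh S. a_h \<theta> \<gamma> S v v \<ge> 1/2 * triple_norm_sq S v)"
    using coercivity[OF _ \<delta>(1) small] unfolding \<gamma>0_def by blast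
  moreover have "(1/2::real) > 0" by simp
  ultimately show ?thesis by blast
qed

end
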